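(* Let $R$ be a commutative ring and let $M$ be a finitely generated $R$-module. For any submodule $N$ of $M$, we have $\sqrt{N}=\bigcup_{i\geq 1} N^{(i)}$.
   Context: All rings are unital, associative and commutative, and all modules are unital. For a submodule $N$ of an $R$-module $M$ and $m\in M$, write $(N:m)=\{r\in R \mid rm\in N\}$, an ideal of $R$. For an ideal $I$ of $R$, $IM$ denotes the submodule of $M$ generated by all $am'$ with $a\in I$, $m'\in M$. A submodule $P$ of $M$ is called prime if for all $r\in R$ and $m\in M$, $rm\in P$ implies $rM\subset P$ or $m\in P$. The (prime) radical $\sqrt{N}$ of a submodule $N$ of $M$ is the intersection of all prime submodules of $M$ that contain $N$; if there is no prime submodule of $M$ containing $N$, then $\sqrt{N}$ is defined to be $M$. (Requiring prime submodules to be proper yields the same $\sqrt{N}$.) The first radical $N^{(1)}$ of a submodule $N$ of $M$ is the submodule of $M$ generated by all $m\in M$ such that $m\in (N:m)M$. Inductively, for $i\geq 2$, the $i$-th radical of $N$ is $N^{(i)}=\left(N^{(i-1)}\right)^{(1)}$. One has $N\subset N^{(1)}\subset\cdots\subset N^{(i)}\subset\cdots$. *)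

theory Defs
  imports "HOL-Algebra.Module"
begin

definition gen_submodule :: "('a, 'r) ring_scheme \<Rightarrow> ('a, 'b, 'm) module_scheme \<Rightarrow> 'b set \<Rightarrow> 'b set"
  where "gen_submodule R M S = \<Inter>{H. submodule H R M \<and> S \<subseteq> H}"

definition fin_gen_module :: "('a, 'r) ring_scheme \<Rightarrow> ('a, 'b, 'm) module_scheme \<Rightarrow> bool"
  where "fin_gen_module R M \<longleftrightarrow>
    (\<exists>S. finite S \<and> S \<subseteq> carrier M \<and> gen_submodule R M S = carrier M)"

definition colon_ideal ::
    "('a, 'r) ring_scheme \<Rightarrow> ('a, 'b, 'm) module_scheme \<Rightarrow> 'b set \<Rightarrow> 'b \<Rightarrow> 'a set"
  where "colon_ideal R M N m = {r \<in> carrier R. r \<odot>\<^bsub>M\<^esub> m \<in> N}"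

definition ideal_smult_module ::
    "('a, 'r) ring_scheme \<Rightarrow> ('a, 'b, 'm) module_scheme \<Rightarrow> 'a set \<Rightarrow> 'b set"
  where "ideal_smult_module R M I =
    gen_submodule R M {a \<odot>\<^bsub>M\<^esub> x | a x. a \<in> I \<and> x \<in> carrier M}"

(* Properness is deliberately not required, so P = carrier M is prime. *)
locale prime_submodule = submodule P R M
  for P and R :: "('a, 'r) ring_scheme" and M :: "('a, 'b, 'm) module_scheme" (structure) +
  assumes prime: "\<lbrakk>r \<in> carrier R; m \<in> carrier M; r \<odot> m \<in> P\<rbrakk>
    \<Longrightarrow> (\<lambda>x. r \<odot> x) ` carrier M \<subseteq> P \<or> m \<in> P"

definition prime_radical ::
    "('a, 'r) ring_scheme \<Rightarrow> ('a, 'b, 'm) module_scheme \<Rightarrow> 'b set \<Rightarrow> 'b set"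
  where "prime_radical R M N =
    (if \<exists>P. prime_submodule P R M \<and> N \<subseteq> P
     then \<Inter>{P. prime_submodule P R M \<and> N \<subseteq> P}
     else carrier M)"

definition first_radical ::
    "('a, 'r) ring_scheme \<Rightarrow> ('a, 'b, 'm) module_scheme \<Rightarrow> 'b set \<Rightarrow> 'b set"
  where "first_radical R M N =
    gen_submodule R M {m \<in> carrier M. m \<in> ideal_smult_module R M (colon_ideal R M N m)}"

(* Index 0, not part of the usual definition, is N itself; thus index 1 is the first radical. *)
primrec ith_radical ::
    "('a, 'r) ring_scheme \<Rightarrow> ('a, 'b, 'm) module_scheme \<Rightarrow> 'b set \<Rightarrow> nat \<Rightarrow> 'b set"
  where
    "ith_radical R M N 0 = N"
  | "ith_radical R M N (Suc i) = first_radical R M (ith_radical R M N i)"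

end

theory Submission
  imports Defs
begin

text \<open>
  Call a submodule \<open>K\<close> \<^emph>\<open>radically closed\<close> if it equals its first radical, that is, if
  \<open>m \<in> (K : m) M\<close> implies \<open>m \<in> K\<close>. The theorem says that the union of the iterated radicals of \<open>N\<close>
  is cut out by prime submodules, and it splits into three facts.

  Prime submodules are radically closed: if \<open>m\<close> lies outside a prime \<open>P\<close>, then every \<open>r\<close> with
  \<open>r m \<in> P\<close> maps \<open>M\<close> into \<open>P\<close>, so \<open>(P : m) M \<subseteq> P\<close>. Since the first radical is
  monotone, a prime submodule above \<open>N\<close> contains every iterated radical of \<open>N\<close>.

  The union \<open>U\<close> of the iterated radicals is radically closed: an element of \<open>(U : m) M\<close> only
  involves finitely many \<open>a\<close> with \<open>a m \<in> U\<close>, and these products already lie in one common stage of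
  the chain, so that \<open>m\<close> lies in the next stage.

  The main point is that a radically closed \<open>K\<close> is an intersection of primes
  (\<open>radically_closed_separation\<close>). Given \<open>x \<notin> K\<close>, choose by Zorn's lemma a maximal
  multiplicative set \<open>S\<close> with \<open>s x \<notin> K\<close> for all \<open>s \<in> S\<close>, and put \<open>p = R - S\<close>; this \<open>p\<close> is a
  minimal prime over \<open>(K : x)\<close>. The elements \<open>y\<close> with \<open>s y \<in> K + p M\<close> for some \<open>s \<in> S\<close> form a
  prime submodule \<open>P\<close> containing \<open>K\<close>. To see that \<open>x \<notin> P\<close>, replace \<open>K\<close> by
  its saturation \<open>L\<close> at \<open>S\<close>, which is again radically closed; maximality of \<open>S\<close> says that every
  element of \<open>p\<close> has a power that sends \<open>x\<close> into \<open>L\<close>. If \<open>s x\<close> were in \<open>L + A M\<close>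
  with a finite \<open>A \<subseteq> p\<close>, there would be a last monomial \<open>c\<close> in the elements of \<open>A\<close> with
  \<open>c s x \<notin> L\<close>. Then \<open>w = c s x\<close> is sent into \<open>L\<close> by all of \<open>A\<close> and lies in \<open>L + A M\<close>, and so in \<open>L\<close>
  by radical closedness, a contradiction (\<open>radically_closed_avoids_nilpotents\<close>).
\<close>

section \<open>Generated submodules and products with sets of scalars\<close>

definition radically_closed ::
    "('a, 'r) ring_scheme \<Rightarrow> ('a, 'b, 'm) module_scheme \<Rightarrow> 'b set \<Rightarrow> bool"
  where "radically_closed R M K \<longleftrightarrow>
    (\<forall>m\<in>carrier M. m \<in> ideal_smult_module R M (colon_ideal R M K m) \<longrightarrow> m \<in> K)"

context module
begin

lemma submodule_no_minusI:
  assumes "H \<subseteq> carrier M" "\<zero>\<^bsub>M\<^esub> \<in> H"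
    and "\<And>a b. \<lbrakk>a \<in> H; b \<in> H\<rbrakk> \<Longrightarrow> a \<oplus>\<^bsub>M\<^esub> b \<in> H"
    and smult: "\<And>a x. \<lbrakk>a \<in> carrier R; x \<in> H\<rbrakk> \<Longrightarrow> a \<odot>\<^bsub>M\<^esub> x \<in> H"
  shows "submodule H R M"
proof (rule submoduleI)
  fix a assume a: "a \<in> H"
  then have "\<ominus>\<^bsub>M\<^esub> a = (\<ominus> \<one>) \<odot>\<^bsub>M\<^esub> a"
    using assms(1) smult_l_minus[of \<one> a] by auto
  then show "\<ominus>\<^bsub>M\<^esub> a \<in> H" using smult[of "\<ominus> \<one>" a] a by auto
qed (use assms in auto)

lemma submodule_zero: "submodule H R M \<Longrightarrow> \<zero>\<^bsub>M\<^esub> \<in> H"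
  using subgroup.one_closed[OF submodule.axioms(1)] by fastforce

lemma submodule_mem_carrier: "\<lbrakk>submodule H R M; x \<in> H\<rbrakk> \<Longrightarrow> x \<in> carrier M"
  using submoduleE(1) by blast

lemma submodule_add_cancel:
  assumes H: "submodule H R M" and "k \<in> H" "z \<in> carrier M" "k \<oplus>\<^bsub>M\<^esub> z \<in> H"
  shows "z \<in> H"
proof -
  have k: "k \<in> carrier M" using assms submodule_mem_carrier by blast
  have "\<ominus>\<^bsub>M\<^esub> k \<oplus>\<^bsub>M\<^esub> (k \<oplus>\<^bsub>M\<^esub> z) = z" using k assms(3) by (simp add: M.r_neg1)
  then show ?thesis using submoduleE(3,5)[OF H] assms(2,4) by metis
qed

lemma gen_submodule_is_submodule:
  assumes "S \<subseteq> carrier M"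
  shows "submodule (gen_submodule R M S) R M"
proof (rule submodule_no_minusI)
  show "gen_submodule R M S \<subseteq> carrier M"
    unfolding gen_submodule_def using carrier_is_submodule assms by blast
qed (auto simp: gen_submodule_def submodule_zero submoduleE)

lemma gen_submodule_superset: "S \<subseteq> gen_submodule R M S"
  unfolding gen_submodule_def by blast

lemma gen_submodule_least: "\<lbrakk>submodule H R M; S \<subseteq> H\<rbrakk> \<Longrightarrow> gen_submodule R M S \<subseteq> H"
  unfolding gen_submodule_def by blast

lemma gen_submodule_mono: "S \<subseteq> T \<Longrightarrow> gen_submodule R M S \<subseteq> gen_submodule R M T"
  unfolding gen_submodule_def by blast

lemma ideal_smult_submodule:
  "I \<subseteq> carrier R \<Longrightarrow> submodule (ideal_smult_module R M I) R M"
  unfolding ideal_smult_module_def by (rule gen_submodule_is_submodule) auto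

lemma ideal_smult_mono: "I \<subseteq> J \<Longrightarrow> ideal_smult_module R M I \<subseteq> ideal_smult_module R M J"
  unfolding ideal_smult_module_def by (rule gen_submodule_mono) blast

lemma ideal_smult_mem:
  "\<lbrakk>a \<in> I; x \<in> carrier M\<rbrakk> \<Longrightarrow> a \<odot>\<^bsub>M\<^esub> x \<in> ideal_smult_module R M I"
  unfolding ideal_smult_module_def by (rule subsetD[OF gen_submodule_superset]) blast

lemma ideal_smult_least:
  assumes "submodule H R M" "\<And>a x. \<lbrakk>a \<in> I; x \<in> carrier M\<rbrakk> \<Longrightarrow> a \<odot>\<^bsub>M\<^esub> x \<in> H"
  shows "ideal_smult_module R M I \<subseteq> H"
  unfolding ideal_smult_module_def using assms by (intro gen_submodule_least) auto

text \<open>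
  This replaces writing elements of \<open>I M\<close> as finite sums. The \<open>y\<close> with a finite support form a submodule, since
  two finite supports have a finite union, and it contains the generators \<open>a x\<close>.
\<close>
lemma ideal_smult_finite_support:
  assumes I: "I \<subseteq> carrier R" and y: "y \<in> ideal_smult_module R M I"
  obtains A where "finite A" "A \<subseteq> I" "y \<in> ideal_smult_module R M A"
proof -
  define H where "H = {y. \<exists>A. finite A \<and> A \<subseteq> I \<and> y \<in> ideal_smult_module R M A}"
  have sub: "submodule (ideal_smult_module R M A) R M" if "A \<subseteq> I" for A
    using that I by (intro ideal_smult_submodule) blast
  have "submodule H R M"
  proof (rule submodule_no_minusI)
    show "H \<subseteq> carrier M" unfolding H_def using sub submodule_mem_carrier by blast
    show "\<zero>\<^bsub>M\<^esub> \<in> H" unfolding H_def using submodule_zero[OF sub[of "{}"]] by blast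
  next
    fix a b assume "a \<in> H" "b \<in> H"
    then obtain A B where A: "finite A" "A \<subseteq> I" "a \<in> ideal_smult_module R M A"
      and B: "finite B" "B \<subseteq> I" "b \<in> ideal_smult_module R M B" unfolding H_def by blast
    have "a \<oplus>\<^bsub>M\<^esub> b \<in> ideal_smult_module R M (A \<union> B)"
      using submoduleE(5)[OF sub[of "A \<union> B"]] A B
        ideal_smult_mono[of A "A \<union> B"] ideal_smult_mono[of B "A \<union> B"] by blast
    then show "a \<oplus>\<^bsub>M\<^esub> b \<in> H" unfolding H_def using A B by blast
  next
    fix a x assume "a \<in> carrier R" "x \<in> H"
    then show "a \<odot>\<^bsub>M\<^esub> x \<in> H" unfolding H_def using submoduleE(4)[OF sub] by blast
  qed
  moreover have "a \<odot>\<^bsub>M\<^esub> x \<in> H" if "a \<in> I" "x \<in> carrier M" for a x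
    unfolding H_def using ideal_smult_mem[of a "{a}" x] that by blast
  ultimately have "y \<in> H" using ideal_smult_least y by blast
  then show thesis using that unfolding H_def by blast
qed

lemma colon_ideal_subset: "colon_ideal R M K m \<subseteq> carrier R"
  unfolding colon_ideal_def by blast

lemma smult_commute:
  assumes "a \<in> carrier R" "b \<in> carrier R" "x \<in> carrier M"
  shows "a \<odot>\<^bsub>M\<^esub> (b \<odot>\<^bsub>M\<^esub> x) = b \<odot>\<^bsub>M\<^esub> (a \<odot>\<^bsub>M\<^esub> x)"
  using assms by (metis smult_assoc1 R.m_comm)

lemma radically_closedD:
  assumes "radically_closed R M K" "m \<in> carrier M" "A \<subseteq> carrier R"
    "m \<in> ideal_smult_module R M A" "\<And>a. a \<in> A \<Longrightarrow> a \<odot>\<^bsub>M\<^esub> m \<in> K"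
  shows "m \<in> K"
proof -
  have "A \<subseteq> colon_ideal R M K m" unfolding colon_ideal_def using assms by blast
  then show ?thesis
    using assms ideal_smult_mono unfolding radically_closed_def by blast
qed


section \<open>Separating a point from a radically closed submodule\<close>

text \<open>
  For a multiplicative set \<open>S\<close> this is the kernel of the map from \<open>M\<close> to the localisation of
  \<open>M / K\<close> at \<open>S\<close>.
\<close>
definition saturation :: "'a set \<Rightarrow> 'c set \<Rightarrow> 'c set"
  where "saturation S K = {y \<in> carrier M. \<exists>s\<in>S. s \<odot>\<^bsub>M\<^esub> y \<in> K}"

lemma saturation_submodule:
  assumes S: "submonoid S R" and K: "submodule K R M"
  shows "submodule (saturation S K) R M"
proof (rule submodule_no_minusI)
  note Sc = submonoid.mem_carrier[OF S]
  show "saturation S K \<subseteq> carrier M" unfolding saturation_def by blast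
  show "\<zero>\<^bsub>M\<^esub> \<in> saturation S K"
    unfolding saturation_def using submodule_zero[OF K] submonoid.one_closed[OF S] by force
  fix a x assume a: "a \<in> carrier R" and "x \<in> saturation S K"
  then obtain s where s: "s \<in> S" "x \<in> carrier M" "s \<odot>\<^bsub>M\<^esub> x \<in> K" unfolding saturation_def by blast
  then have "s \<odot>\<^bsub>M\<^esub> (a \<odot>\<^bsub>M\<^esub> x) \<in> K"
    using a Sc submoduleE(4)[OF K, of a "s \<odot>\<^bsub>M\<^esub> x"] smult_commute[of s a x] by metis
  then show "a \<odot>\<^bsub>M\<^esub> x \<in> saturation S K" unfolding saturation_def using s a by blast
next
  note Sc = submonoid.mem_carrier[OF S]
  fix x y assume "x \<in> saturation S K" "y \<in> saturation S K"
  then obtain s t where s: "s \<in> S" "x \<in> carrier M" "s \<odot>\<^bsub>M\<^esub> x \<in> K"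
    and t: "t \<in> S" "y \<in> carrier M" "t \<odot>\<^bsub>M\<^esub> y \<in> K" unfolding saturation_def by blast
  have "(s \<otimes> t) \<odot>\<^bsub>M\<^esub> (x \<oplus>\<^bsub>M\<^esub> y) = t \<odot>\<^bsub>M\<^esub> (s \<odot>\<^bsub>M\<^esub> x) \<oplus>\<^bsub>M\<^esub> s \<odot>\<^bsub>M\<^esub> (t \<odot>\<^bsub>M\<^esub> y)"
    using s t Sc by (simp add: smult_r_distr smult_assoc1 smult_commute[of s t x])
  then have "(s \<otimes> t) \<odot>\<^bsub>M\<^esub> (x \<oplus>\<^bsub>M\<^esub> y) \<in> K"
    using submoduleE(4,5)[OF K] s t Sc by auto
  then show "x \<oplus>\<^bsub>M\<^esub> y \<in> saturation S K"
    unfolding saturation_def using s t submonoid.m_closed[OF S] by auto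
qed

lemma saturation_superset:
  assumes "submonoid S R" "submodule K R M"
  shows "K \<subseteq> saturation S K"
  unfolding saturation_def
  using submonoid.one_closed[OF assms(1)] submodule_mem_carrier[OF assms(2)] by force

lemma saturation_cancel:
  assumes S: "submonoid S R" and "s \<in> S" "y \<in> carrier M" "s \<odot>\<^bsub>M\<^esub> y \<in> saturation S K"
  shows "y \<in> saturation S K"
proof -
  obtain t where t: "t \<in> S" "t \<odot>\<^bsub>M\<^esub> (s \<odot>\<^bsub>M\<^esub> y) \<in> K" using assms(4) unfolding saturation_def by blast
  then have "(t \<otimes> s) \<odot>\<^bsub>M\<^esub> y \<in> K"
    using assms submonoid.mem_carrier[OF S] by (simp add: smult_assoc1)
  then show ?thesis
    unfolding saturation_def using assms t submonoid.m_closed[OF S] by auto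
qed

lemma saturation_common_multiplier:
  assumes S: "submonoid S R" and K: "submodule K R M"
    and "finite B" "B \<subseteq> saturation S K"
  shows "\<exists>s\<in>S. \<forall>y\<in>B. s \<odot>\<^bsub>M\<^esub> y \<in> K"
  using assms(3,4)
proof (induction B)
  case empty
  then show ?case using submonoid.one_closed[OF S] by blast
next
  note Sc = submonoid.mem_carrier[OF S]
  case (insert y B)
  then obtain s t where s: "s \<in> S" "\<forall>y\<in>B. s \<odot>\<^bsub>M\<^esub> y \<in> K" and t: "t \<in> S" "t \<odot>\<^bsub>M\<^esub> y \<in> K"
    unfolding saturation_def by auto
  have car: "insert y B \<subseteq> carrier M" using insert.prems unfolding saturation_def by blast
  have "(s \<otimes> t) \<odot>\<^bsub>M\<^esub> z \<in> K" if z: "z \<in> insert y B" for z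
  proof (cases "z = y")
    case True
    then show ?thesis using s t Sc car submoduleE(4)[OF K] by (auto simp: smult_assoc1)
  next
    case False
    then have "(s \<otimes> t) \<odot>\<^bsub>M\<^esub> z = t \<odot>\<^bsub>M\<^esub> (s \<odot>\<^bsub>M\<^esub> z)" "s \<odot>\<^bsub>M\<^esub> z \<in> K"
      using s t z Sc car smult_commute[of s t z] by (auto simp: smult_assoc1)
    then show ?thesis using t Sc submoduleE(4)[OF K] by auto
  qed
  then show ?case using s t submonoid.m_closed[OF S] by blast
qed

text \<open>
  Localisation at a multiplicative set preserves radical closedness: finitely many witnesses
  \<open>a m\<close> in the saturation have a common denominator \<open>s\<close>, and then \<open>s m\<close> satisfies the defining
  condition for \<open>K\<close>.
\<close>
lemma radically_closed_saturation:
  assumes S: "submonoid S R" and K: "submodule K R M" and rc: "radically_closed R M K"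
  shows "radically_closed R M (saturation S K)"
  unfolding radically_closed_def
proof (intro ballI impI)
  fix m assume m: "m \<in> carrier M"
    and mem: "m \<in> ideal_smult_module R M (colon_ideal R M (saturation S K) m)"
  obtain A where A: "finite A" "A \<subseteq> colon_ideal R M (saturation S K) m"
    "m \<in> ideal_smult_module R M A"
    using ideal_smult_finite_support[OF colon_ideal_subset mem] by blast
  have AR: "A \<subseteq> carrier R" using A(2) colon_ideal_subset by blast
  have "(\<lambda>a. a \<odot>\<^bsub>M\<^esub> m) ` A \<subseteq> saturation S K" using A(2) unfolding colon_ideal_def by blast
  then obtain s where s: "s \<in> S" "\<forall>a\<in>A. s \<odot>\<^bsub>M\<^esub> (a \<odot>\<^bsub>M\<^esub> m) \<in> K"
    using saturation_common_multiplier[OF S K, of "(\<lambda>a. a \<odot>\<^bsub>M\<^esub> m) ` A"] A(1) by auto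
  have sR: "s \<in> carrier R" using s(1) submonoid.mem_carrier[OF S] by blast
  have "s \<odot>\<^bsub>M\<^esub> m \<in> K"
  proof (rule radically_closedD[OF rc])
    show "s \<odot>\<^bsub>M\<^esub> m \<in> ideal_smult_module R M A"
      using A(3) sR submoduleE(4)[OF ideal_smult_submodule[OF AR]] by blast
    show "a \<odot>\<^bsub>M\<^esub> (s \<odot>\<^bsub>M\<^esub> m) \<in> K" if "a \<in> A" for a
      using that s(2) AR sR m smult_commute[of a s m] by auto
  qed (use m sR AR in auto)
  then show "m \<in> saturation S K" unfolding saturation_def using m s(1) by blast
qed

text \<open>
  The scalar \<open>c\<close> is a monomial in the elements of \<open>A\<close>; it is built one element \<open>a\<close> at a time, each
  contributing its largest power that does not yet push the vector into \<open>L\<close>.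
\<close>
lemma last_nonvanishing_multiple:
  assumes L: "submodule L R M" and x: "x \<in> carrier M" "x \<notin> L"
    and "finite A" "A \<subseteq> carrier R"
    and "\<And>a. a \<in> A \<Longrightarrow> \<exists>n::nat. (a [^] n) \<odot>\<^bsub>M\<^esub> x \<in> L"
  shows "\<exists>c\<in>carrier R. c \<odot>\<^bsub>M\<^esub> x \<notin> L \<and> (\<forall>a\<in>A. a \<odot>\<^bsub>M\<^esub> (c \<odot>\<^bsub>M\<^esub> x) \<in> L)"
  using assms(4-6)
proof (induction A)
  case empty
  then show ?case using x by (intro bexI[of _ \<one>]) auto
next
  case (insert a A)
  then obtain c where c: "c \<in> carrier R" "c \<odot>\<^bsub>M\<^esub> x \<notin> L" "\<forall>b\<in>A. b \<odot>\<^bsub>M\<^esub> (c \<odot>\<^bsub>M\<^esub> x) \<in> L" by auto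
  define y where "y = c \<odot>\<^bsub>M\<^esub> x"
  have y: "y \<in> carrier M" "y \<notin> L" using c x unfolding y_def by auto
  have a: "a \<in> carrier R" using insert.prems by auto
  obtain N :: nat where "(a [^] N) \<odot>\<^bsub>M\<^esub> x \<in> L" using insert.prems by auto
  then have N: "(a [^] N) \<odot>\<^bsub>M\<^esub> y \<in> L"
    unfolding y_def using smult_commute[of "a [^] N" c x] a c x submoduleE(4)[OF L] by auto
  define n where "n = (LEAST n::nat. (a [^] n) \<odot>\<^bsub>M\<^esub> y \<in> L)"
  have n: "(a [^] n) \<odot>\<^bsub>M\<^esub> y \<in> L"
    unfolding n_def using N by (rule LeastI[where P = "\<lambda>n. (a [^] n) \<odot>\<^bsub>M\<^esub> y \<in> L"])
  have "n \<noteq> 0" using n y by (metis R.nat_pow_0 smult_one)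
  then obtain k where k: "n = Suc k" using not0_implies_Suc by blast
  have notin: "(a [^] k) \<odot>\<^bsub>M\<^esub> y \<notin> L"
    using not_less_Least[of k "\<lambda>n. (a [^] n) \<odot>\<^bsub>M\<^esub> y \<in> L"] k n_def by auto
  have eq: "(a [^] k \<otimes> c) \<odot>\<^bsub>M\<^esub> x = (a [^] k) \<odot>\<^bsub>M\<^esub> y"
    unfolding y_def using a c x by (simp add: smult_assoc1)
  have "b \<odot>\<^bsub>M\<^esub> ((a [^] k) \<odot>\<^bsub>M\<^esub> y) \<in> L" if b: "b \<in> insert a A" for b
  proof (cases "b = a")
    case True
    have "a \<odot>\<^bsub>M\<^esub> ((a [^] k) \<odot>\<^bsub>M\<^esub> y) = (a [^] n) \<odot>\<^bsub>M\<^esub> y"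
      unfolding k using a y by (simp add: smult_assoc1[symmetric] R.m_comm)
    then show ?thesis using n True by simp
  next
    case False
    then have "b \<in> carrier R" "b \<odot>\<^bsub>M\<^esub> y \<in> L" using b insert.prems c y_def by auto
    then show ?thesis
      using smult_commute[of b "a [^] k" y] a y submoduleE(4)[OF L] by auto
  qed
  then show ?case using notin eq a c by (intro bexI[of _ "a [^] k \<otimes> c"]) auto
qed

lemma radically_closed_avoids_nilpotents:
  assumes L: "submodule L R M" and rc: "radically_closed R M L"
    and x: "x \<in> carrier M" "x \<notin> L"
    and A: "A \<subseteq> carrier R" and nil: "\<And>a. a \<in> A \<Longrightarrow> \<exists>n::nat. (a [^] n) \<odot>\<^bsub>M\<^esub> x \<in> L"
    and l: "l \<in> L" and z: "z \<in> ideal_smult_module R M A"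
  shows "x \<noteq> l \<oplus>\<^bsub>M\<^esub> z"
proof
  assume xeq: "x = l \<oplus>\<^bsub>M\<^esub> z"
  obtain B where B: "finite B" "B \<subseteq> A" "z \<in> ideal_smult_module R M B"
    using ideal_smult_finite_support[OF A z] by blast
  have BR: "B \<subseteq> carrier R" using B A by blast
  note BM = ideal_smult_submodule[OF BR]
  obtain c where c: "c \<in> carrier R" "c \<odot>\<^bsub>M\<^esub> x \<notin> L" "\<forall>a\<in>B. a \<odot>\<^bsub>M\<^esub> (c \<odot>\<^bsub>M\<^esub> x) \<in> L"
    using last_nonvanishing_multiple[OF L x B(1) BR] nil B(2) by blast
  have lc: "l \<in> carrier M" using l submodule_mem_carrier[OF L] by blast
  have zc: "z \<in> carrier M" using B(3) submodule_mem_carrier[OF BM] by blast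
  have cl: "c \<odot>\<^bsub>M\<^esub> l \<in> L" using c(1) l submoduleE(4)[OF L] by blast
  have cx: "c \<odot>\<^bsub>M\<^esub> x = c \<odot>\<^bsub>M\<^esub> l \<oplus>\<^bsub>M\<^esub> c \<odot>\<^bsub>M\<^esub> z" unfolding xeq using c lc zc by (simp add: smult_r_distr)
  (* Closedness applies to c z rather than to c x, because c z is the part lying in B M. *)
  have "c \<odot>\<^bsub>M\<^esub> z \<in> L"
  proof (rule radically_closedD[OF rc _ BR])
    show "c \<odot>\<^bsub>M\<^esub> z \<in> ideal_smult_module R M B" using B(3) c(1) submoduleE(4)[OF BM] by blast
    fix a assume a: "a \<in> B"
    then have aR: "a \<in> carrier R" using BR by blast
    have "a \<odot>\<^bsub>M\<^esub> (c \<odot>\<^bsub>M\<^esub> l) \<oplus>\<^bsub>M\<^esub> a \<odot>\<^bsub>M\<^esub> (c \<odot>\<^bsub>M\<^esub> z) \<in> L"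
      using c(1,3) a aR cx lc zc by (auto simp: smult_r_distr)
    moreover have "a \<odot>\<^bsub>M\<^esub> (c \<odot>\<^bsub>M\<^esub> l) \<in> L" using cl aR submoduleE(4)[OF L] by blast
    ultimately show "a \<odot>\<^bsub>M\<^esub> (c \<odot>\<^bsub>M\<^esub> z) \<in> L"
      using submodule_add_cancel[OF L] aR c(1) zc by blast
  qed (use c zc in auto)
  then show False using c(2) cx cl submoduleE(5)[OF L] by auto
qed

text \<open>
  A maximal multiplicative set that keeps \<open>x\<close> out of \<open>K\<close> is the complement of a minimal prime over
  \<open>(K : x)\<close>. Adjoining the powers of an outside element \<open>a\<close> produces a strictly larger
  multiplicative set, some element of which must send \<open>x\<close> into \<open>K\<close>.
\<close>
lemma exists_maximal_avoiding_submonoid: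
  assumes x: "x \<in> carrier M" "x \<notin> K"
  obtains S where "submonoid S R" "\<And>s. s \<in> S \<Longrightarrow> s \<odot>\<^bsub>M\<^esub> x \<notin> K"
    "\<And>a. a \<in> carrier R - S \<Longrightarrow> \<exists>s\<in>S. \<exists>n::nat. (s \<otimes> a [^] n) \<odot>\<^bsub>M\<^esub> x \<in> K"
proof -
  define \<A> where "\<A> = {S. submonoid S R \<and> (\<forall>s\<in>S. s \<odot>\<^bsub>M\<^esub> x \<notin> K)}"
  have "{\<one>} \<in> \<A>" unfolding \<A>_def using x by (auto intro!: submonoid.intro)
  moreover have "\<Union>C \<in> \<A>" if C: "C \<noteq> {}" "subset.chain \<A> C" for C
  proof -
    have CA: "\<And>S. S \<in> C \<Longrightarrow> S \<in> \<A>" and lin: "\<And>S T. S \<in> C \<Longrightarrow> T \<in> C \<Longrightarrow> S \<subseteq> T \<or> T \<subseteq> S"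
      using C(2) unfolding subset.chain_def subset_chain_def by blast+
    then have sub: "submonoid S R" if "S \<in> C" for S using that unfolding \<A>_def by blast
    have "submonoid (\<Union>C) R"
    proof
      show "\<Union>C \<subseteq> carrier R" using submonoid.subset[OF sub] by blast
      show "\<one> \<in> \<Union>C" using C(1) submonoid.one_closed[OF sub] by blast
      fix s t assume "s \<in> \<Union>C" "t \<in> \<Union>C"
      then obtain T where "T \<in> C" "s \<in> T" "t \<in> T" using lin by blast
      then show "s \<otimes> t \<in> \<Union>C" using submonoid.m_closed[OF sub] by blast
    qed
    then show ?thesis using CA unfolding \<A>_def by blast
  qed
  ultimately obtain S where S: "S \<in> \<A>" and max: "\<And>T. T \<in> \<A> \<Longrightarrow> S \<subseteq> T \<Longrightarrow> T = S"
    using subset_Zorn_nonempty[of \<A>] by blast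
  have Sm: "submonoid S R" and av: "\<And>s. s \<in> S \<Longrightarrow> s \<odot>\<^bsub>M\<^esub> x \<notin> K" using S unfolding \<A>_def by auto
  note Sc = submonoid.mem_carrier[OF Sm] and S1 = submonoid.one_closed[OF Sm]
  have "\<exists>s\<in>S. \<exists>n::nat. (s \<otimes> a [^] n) \<odot>\<^bsub>M\<^esub> x \<in> K" if a: "a \<in> carrier R - S" for a
  proof (rule ccontr)
    assume no: "\<not> ?thesis"
    have aR: "a \<in> carrier R" using a by blast
    define T where "T = {s \<otimes> a [^] n | s (n::nat). s \<in> S}"
    have "submonoid T R"
    proof
      show "T \<subseteq> carrier R" unfolding T_def using Sc aR by auto
      have "\<one> = \<one> \<otimes> a [^] (0::nat)" by simp
      then show "\<one> \<in> T" unfolding T_def using S1 by blast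
      fix u v assume "u \<in> T" "v \<in> T"
      then obtain s t and n k :: nat where uv: "u = s \<otimes> a [^] n" "v = t \<otimes> a [^] k" "s \<in> S" "t \<in> S"
        unfolding T_def by blast
      have "u \<otimes> v = (s \<otimes> t) \<otimes> a [^] (n + k)"
        using uv Sc aR by (simp add: R.nat_pow_mult[symmetric] R.m_ac)
      then show "u \<otimes> v \<in> T" unfolding T_def using uv submonoid.m_closed[OF Sm] by blast
    qed
    then have "T \<in> \<A>" unfolding \<A>_def using no T_def by blast
    moreover have "S \<subseteq> T"
    proof
      fix s assume s: "s \<in> S"
      then have "s = s \<otimes> a [^] (0::nat)" using Sc by simp
      then show "s \<in> T" unfolding T_def using s by blast
    qed
    moreover have "a = \<one> \<otimes> a [^] (1::nat)" using aR by simp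
    then have "a \<in> T" unfolding T_def using S1 by blast
    ultimately show False using max a by blast
  qed
  then show thesis using that Sm av by blast
qed

text \<open>
  With \<open>p = R - S\<close>, the saturation of \<open>Q = K + p M\<close> is the preimage in \<open>M\<close> of the localisation of
  \<open>Q\<close> at \<open>S\<close>. Suppose \<open>r m\<close> lies in it. If \<open>r \<in> S\<close>, then \<open>r\<close> can be absorbed into the
  denominator, so \<open>m\<close> lies in it; if \<open>r \<in> p\<close>, then \<open>r M \<subseteq> p M\<close>.
\<close>
lemma prime_submodule_of_submonoid:
  assumes S: "submonoid S R" and K: "submodule K R M"
  defines "Q \<equiv> {k \<oplus>\<^bsub>M\<^esub> z | k z. k \<in> K \<and> z \<in> ideal_smult_module R M (carrier R - S)}"
  shows "prime_submodule (saturation S Q) R M" and "K \<subseteq> saturation S Q"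
proof -
  let ?pM = "ideal_smult_module R M (carrier R - S)"
  have pM: "submodule ?pM R M" by (rule ideal_smult_submodule) blast
  note Kc = submodule_mem_carrier[OF K] and pMc = submodule_mem_carrier[OF pM]
  have Q: "submodule Q R M"
  proof (rule submodule_no_minusI)
    show "Q \<subseteq> carrier M" unfolding Q_def using Kc pMc by auto
    have "\<zero>\<^bsub>M\<^esub> = \<zero>\<^bsub>M\<^esub> \<oplus>\<^bsub>M\<^esub> \<zero>\<^bsub>M\<^esub>" by simp
    then show "\<zero>\<^bsub>M\<^esub> \<in> Q" unfolding Q_def using submodule_zero[OF K] submodule_zero[OF pM] by blast
  next
    fix u v assume "u \<in> Q" "v \<in> Q"
    then obtain k z k' z' where uv: "u = k \<oplus>\<^bsub>M\<^esub> z" "v = k' \<oplus>\<^bsub>M\<^esub> z'"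
      and mem: "k \<in> K" "z \<in> ?pM" "k' \<in> K" "z' \<in> ?pM" unfolding Q_def by blast
    then have "u \<oplus>\<^bsub>M\<^esub> v = (k \<oplus>\<^bsub>M\<^esub> k') \<oplus>\<^bsub>M\<^esub> (z \<oplus>\<^bsub>M\<^esub> z')"
      using Kc pMc by (simp add: M.a_ac)
    then show "u \<oplus>\<^bsub>M\<^esub> v \<in> Q"
      unfolding Q_def using mem submoduleE(5)[OF K] submoduleE(5)[OF pM] by blast
  next
    fix a u assume a: "a \<in> carrier R" and "u \<in> Q"
    then obtain k z where u: "u = k \<oplus>\<^bsub>M\<^esub> z" "k \<in> K" "z \<in> ?pM" unfolding Q_def by blast
    then have "a \<odot>\<^bsub>M\<^esub> u = a \<odot>\<^bsub>M\<^esub> k \<oplus>\<^bsub>M\<^esub> a \<odot>\<^bsub>M\<^esub> z" using a Kc pMc by (simp add: smult_r_distr)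
    then show "a \<odot>\<^bsub>M\<^esub> u \<in> Q"
      unfolding Q_def using a u submoduleE(4)[OF K] submoduleE(4)[OF pM] by blast
  qed
  have KQ: "K \<subseteq> Q"
  proof
    fix k assume k: "k \<in> K"
    then have "k = k \<oplus>\<^bsub>M\<^esub> \<zero>\<^bsub>M\<^esub>" using Kc by simp
    then show "k \<in> Q" unfolding Q_def using k submodule_zero[OF pM] by blast
  qed
  have pMQ: "?pM \<subseteq> Q"
  proof
    fix z assume z: "z \<in> ?pM"
    then have "z = \<zero>\<^bsub>M\<^esub> \<oplus>\<^bsub>M\<^esub> z" using pMc by simp
    then show "z \<in> Q" unfolding Q_def using z submodule_zero[OF K] by blast
  qed
  note QP = saturation_superset[OF S Q]
  show "K \<subseteq> saturation S Q" using KQ QP by blast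
  show "prime_submodule (saturation S Q) R M"
  proof (rule prime_submodule.intro[OF saturation_submodule[OF S Q]], unfold_locales)
    fix r m assume r: "r \<in> carrier R" and m: "m \<in> carrier M" and rm: "r \<odot>\<^bsub>M\<^esub> m \<in> saturation S Q"
    show "(\<odot>\<^bsub>M\<^esub>) r ` carrier M \<subseteq> saturation S Q \<or> m \<in> saturation S Q"
    proof (cases "r \<in> S")
      case True
      then show ?thesis using saturation_cancel[OF S True m rm] by blast
    next
      case False
      then have "(\<odot>\<^bsub>M\<^esub>) r ` carrier M \<subseteq> ?pM" using r by (auto intro: ideal_smult_mem)
      then show ?thesis using pMQ QP by blast
    qed
  qed
qed

lemma radically_closed_separation:
  assumes K: "submodule K R M" and rc: "radically_closed R M K"
    and x: "x \<in> carrier M" "x \<notin> K"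
  obtains P where "prime_submodule P R M" "K \<subseteq> P" "x \<notin> P"
proof -
  obtain S where S: "submonoid S R" and av: "\<And>s. s \<in> S \<Longrightarrow> s \<odot>\<^bsub>M\<^esub> x \<notin> K"
    and nil: "\<And>a. a \<in> carrier R - S \<Longrightarrow> \<exists>s\<in>S. \<exists>n::nat. (s \<otimes> a [^] n) \<odot>\<^bsub>M\<^esub> x \<in> K"
    using exists_maximal_avoiding_submonoid[OF x] by blast
  note Sc = submonoid.mem_carrier[OF S]
  define L where "L = saturation S K"
  have L: "submodule L R M" and Lrc: "radically_closed R M L" and KL: "K \<subseteq> L"
    unfolding L_def using saturation_submodule[OF S K] radically_closed_saturation[OF S K rc]
      saturation_superset[OF S K] by auto
  have xL: "x \<notin> L" unfolding L_def saturation_def using av by blast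
  define Q where "Q = {k \<oplus>\<^bsub>M\<^esub> z | k z. k \<in> K \<and> z \<in> ideal_smult_module R M (carrier R - S)}"
  have "x \<notin> saturation S Q"
  proof
    assume "x \<in> saturation S Q"
    then obtain s k z where s: "s \<in> S" and k: "k \<in> K"
      and z: "z \<in> ideal_smult_module R M (carrier R - S)" and sx: "s \<odot>\<^bsub>M\<^esub> x = k \<oplus>\<^bsub>M\<^esub> z"
      unfolding saturation_def Q_def by blast
    have sxL: "s \<odot>\<^bsub>M\<^esub> x \<notin> L" using xL saturation_cancel[OF S s x(1)] unfolding L_def by blast
    have "\<exists>n::nat. (a [^] n) \<odot>\<^bsub>M\<^esub> (s \<odot>\<^bsub>M\<^esub> x) \<in> L" if a: "a \<in> carrier R - S" for a
    proof -
      obtain t and n :: nat where t: "t \<in> S" "(t \<otimes> a [^] n) \<odot>\<^bsub>M\<^esub> x \<in> K" using nil[OF a] by blast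
      then have "t \<odot>\<^bsub>M\<^esub> ((a [^] n) \<odot>\<^bsub>M\<^esub> x) \<in> K" using a Sc x(1) by (simp add: smult_assoc1)
      then have "(a [^] n) \<odot>\<^bsub>M\<^esub> x \<in> L" unfolding L_def saturation_def using t(1) a x(1) by auto
      then have "s \<odot>\<^bsub>M\<^esub> ((a [^] n) \<odot>\<^bsub>M\<^esub> x) \<in> L" using submoduleE(4)[OF L] Sc[OF s] by blast
      then show ?thesis using smult_commute[of s "a [^] n" x] a Sc[OF s] x(1) by auto
    qed
    then show False
      using radically_closed_avoids_nilpotents[OF L Lrc _ sxL _ _ _ z, of k] k KL sx Sc[OF s] x(1)
      by blast
  qed
  then show thesis
    using that prime_submodule_of_submonoid[OF S K, folded Q_def] by blast
qed


section \<open>The chain of iterated radicals\<close>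

lemma first_radical_submodule: "submodule (first_radical R M N) R M"
  unfolding first_radical_def by (rule gen_submodule_is_submodule) blast

lemma first_radical_mem:
  "\<lbrakk>m \<in> carrier M; m \<in> ideal_smult_module R M (colon_ideal R M N m)\<rbrakk> \<Longrightarrow> m \<in> first_radical R M N"
  unfolding first_radical_def by (rule subsetD[OF gen_submodule_superset]) blast

lemma first_radical_superset:
  assumes N: "submodule N R M"
  shows "N \<subseteq> first_radical R M N"
proof
  fix m assume m: "m \<in> N"
  then have mc: "m \<in> carrier M" using submodule_mem_carrier[OF N] by blast
  have "\<one> \<in> colon_ideal R M N m" unfolding colon_ideal_def using m mc by simp
  from ideal_smult_mem[OF this mc] show "m \<in> first_radical R M N"
    using first_radical_mem mc by simp
qed

lemma first_radical_mono: "N \<subseteq> N' \<Longrightarrow> first_radical R M N \<subseteq> first_radical R M N'"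
proof -
  assume "N \<subseteq> N'"
  then have "colon_ideal R M N m \<subseteq> colon_ideal R M N' m" for m unfolding colon_ideal_def by blast
  then show ?thesis
    unfolding first_radical_def using ideal_smult_mono by (intro gen_submodule_mono) blast
qed

lemma first_radical_le_prime:
  assumes P: "prime_submodule P R M" and NP: "N \<subseteq> P"
  shows "first_radical R M N \<subseteq> P"
proof -
  have Ps: "submodule P R M" by (rule prime_submodule.axioms(1)[OF P])
  have "first_radical R M P \<subseteq> P"
    unfolding first_radical_def
  proof (intro gen_submodule_least[OF Ps] subsetI, elim CollectE conjE)
    fix m assume m: "m \<in> carrier M" and mem: "m \<in> ideal_smult_module R M (colon_ideal R M P m)"
    show "m \<in> P"
    proof (rule ccontr)
      assume mP: "m \<notin> P"
      have "ideal_smult_module R M (colon_ideal R M P m) \<subseteq> P"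
      proof (rule ideal_smult_least[OF Ps])
        fix a y assume "a \<in> colon_ideal R M P m" and y: "y \<in> carrier M"
        then show "a \<odot>\<^bsub>M\<^esub> y \<in> P"
          using prime_submodule.prime[OF P, of a m] m mP unfolding colon_ideal_def by blast
      qed
      then show False using mem mP by blast
    qed
  qed
  then show ?thesis using first_radical_mono[OF NP] by blast
qed

lemma ith_radical_submodule: "submodule N R M \<Longrightarrow> submodule (ith_radical R M N i) R M"
  by (cases i) (auto simp: first_radical_submodule)

lemma ith_radical_mono:
  assumes N: "submodule N R M"
  shows "i \<le> j \<Longrightarrow> ith_radical R M N i \<subseteq> ith_radical R M N j"
  by (rule lift_Suc_mono_le) (simp_all add: first_radical_superset ith_radical_submodule[OF N])

lemma ith_radical_le_prime:
  "\<lbrakk>prime_submodule P R M; N \<subseteq> P\<rbrakk> \<Longrightarrow> ith_radical R M N i \<subseteq> P"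
  by (induction i) (auto dest: first_radical_le_prime)

lemma ith_radical_common_stage:
  assumes N: "submodule N R M" and "finite B" "B \<subseteq> (\<Union>i. ith_radical R M N i)"
  shows "\<exists>i. B \<subseteq> ith_radical R M N i"
  using assms(2,3)
proof (induction B)
  case (insert y B)
  then obtain i j where "B \<subseteq> ith_radical R M N i" "y \<in> ith_radical R M N j" by auto
  then have "insert y B \<subseteq> ith_radical R M N (max i j)"
    using ith_radical_mono[OF N, of i "max i j"] ith_radical_mono[OF N, of j "max i j"] by auto
  then show ?case by blast
qed simp

lemma Union_ith_radical_submodule:
  assumes N: "submodule N R M"
  shows "submodule (\<Union>i. ith_radical R M N i) R M"
proof (rule submodule_no_minusI)
  note sub = ith_radical_submodule[OF N]
  show "(\<Union>i. ith_radical R M N i) \<subseteq> carrier M" using submodule_mem_carrier[OF sub] by blast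
  show "\<zero>\<^bsub>M\<^esub> \<in> (\<Union>i. ith_radical R M N i)" using submodule_zero[OF sub] by blast
  show "a \<odot>\<^bsub>M\<^esub> x \<in> (\<Union>i. ith_radical R M N i)"
    if "a \<in> carrier R" "x \<in> (\<Union>i. ith_radical R M N i)" for a x
    using that submoduleE(4)[OF sub] by blast
  fix x y assume "x \<in> (\<Union>i. ith_radical R M N i)" "y \<in> (\<Union>i. ith_radical R M N i)"
  then obtain i where "{x, y} \<subseteq> ith_radical R M N i"
    using ith_radical_common_stage[OF N, of "{x, y}"] by auto
  then have "x \<oplus>\<^bsub>M\<^esub> y \<in> ith_radical R M N i" by (intro submoduleE(5)[OF sub]) simp_all
  then show "x \<oplus>\<^bsub>M\<^esub> y \<in> (\<Union>i. ith_radical R M N i)" by (rule UN_I[OF UNIV_I])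
qed

lemma Union_ith_radical_radically_closed:
  assumes N: "submodule N R M"
  shows "radically_closed R M (\<Union>i. ith_radical R M N i)"
  unfolding radically_closed_def
proof (intro ballI impI)
  let ?U = "\<Union>i. ith_radical R M N i"
  fix m assume m: "m \<in> carrier M" and mem: "m \<in> ideal_smult_module R M (colon_ideal R M ?U m)"
  obtain A where A: "finite A" "A \<subseteq> colon_ideal R M ?U m" "m \<in> ideal_smult_module R M A"
    using ideal_smult_finite_support[OF colon_ideal_subset mem] by blast
  have "(\<lambda>a. a \<odot>\<^bsub>M\<^esub> m) ` A \<subseteq> ?U" using A(2) unfolding colon_ideal_def by blast
  then obtain i where "(\<lambda>a. a \<odot>\<^bsub>M\<^esub> m) ` A \<subseteq> ith_radical R M N i"
    using ith_radical_common_stage[OF N finite_imageI[OF A(1)]] by blast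
  then have "A \<subseteq> colon_ideal R M (ith_radical R M N i) m"
    using A(2) unfolding colon_ideal_def by blast
  then have "m \<in> ideal_smult_module R M (colon_ideal R M (ith_radical R M N i) m)"
    by (rule subsetD[OF ideal_smult_mono A(3)])
  then have "m \<in> ith_radical R M N (Suc i)"
    unfolding ith_radical.simps by (rule first_radical_mem[OF m])
  then show "m \<in> ?U" by blast
qed

lemma prime_radical_eq_Inter:
  "prime_radical R M N = carrier M \<inter> \<Inter>{P. prime_submodule P R M \<and> N \<subseteq> P}"
proof -
  have "P \<subseteq> carrier M" if "prime_submodule P R M" for P
    using submoduleE(1)[OF prime_submodule.axioms(1)[OF that]] .
  then show ?thesis unfolding prime_radical_def by auto
qed

end

theorem theorem2p7:
  fixes R :: "('a, 'r) ring_scheme" and M :: "('a, 'b, 'm) module_scheme" and N :: "'b set"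
  assumes "module R M"
    and "fin_gen_module R M"
    and "submodule N R M"
  shows "prime_radical R M N = (\<Union>i\<in>{1..}. ith_radical R M N i)"
proof -
  interpret module R M by (rule assms(1))
  note N = assms(3)
  define U where "U = (\<Union>i. ith_radical R M N i)"
  (* Stage 0 may be included in the union, because it is contained in stage 1. *)
  have "ith_radical R M N i \<subseteq> ith_radical R M N (Suc i)" for i
    using ith_radical_mono[OF N, of i "Suc i"] by simp
  then have U: "(\<Union>i\<in>{1..}. ith_radical R M N i) = U" unfolding U_def by fastforce
  have Usub: "submodule U R M" and Urc: "radically_closed R M U"
    unfolding U_def using Union_ith_radical_submodule[OF N] Union_ith_radical_radically_closed[OF N]
    by auto
  have "ith_radical R M N 0 \<subseteq> U" unfolding U_def by blast
  then have NU: "N \<subseteq> U" by simp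
  have "U \<subseteq> P" if "prime_submodule P R M" "N \<subseteq> P" for P
    unfolding U_def using ith_radical_le_prime[OF that] by blast
  then have "U \<subseteq> prime_radical R M N"
    unfolding prime_radical_eq_Inter using submodule_mem_carrier[OF Usub] by blast
  moreover have "x \<in> U" if x: "x \<in> prime_radical R M N" for x
  proof (rule ccontr)
    assume xU: "x \<notin> U"
    have "x \<in> carrier M" using x unfolding prime_radical_eq_Inter by blast
    then obtain P where "prime_submodule P R M" "U \<subseteq> P" "x \<notin> P"
      using radically_closed_separation[OF Usub Urc _ xU] by blast
    then show False using x NU unfolding prime_radical_eq_Inter by blast
  qed
  ultimately show ?thesis using U by blast
qed

end
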